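(* Let $\mathcal T=(V,\mathcal E)$ be a countably infinite, leafless, rootless directed tree and let $\boldsymbol\lambda=\{\lambda_v\}_{v\in V}$ be positive weights such that the weighted shift $S_{\boldsymbol\lambda}$ is a bounded left-invertible operator on $\ell^2(V)$. For a bilateral path $\mathfrak v=\{v_m\}_{m\in\mathbb Z}$ in $\mathcal T$, let $g_{m,\mathfrak v}$, $m\in\mathbb Z$, be given by $$g_{m,\mathfrak v}=\begin{cases}\displaystyle\sum_{n=0}^\infty\sum_{u\in A(v_m,n)}\frac{\boldsymbol\lambda^{(n)}(u)}{\boldsymbol\lambda^{(n)}(v_m)}\,e_u&\text{if }\alpha_{\boldsymbol\lambda}(v_m)<\infty,\\0&\text{otherwise.}\end{cases}$$ Then $g_{m,\mathfrak v}\in\ell^2(V)$ for every $m\in\mathbb Z$, and $$S_{\boldsymbol\lambda}^\infty(\ell^2(V))=\bigoplus_{m\in\mathbb Z}\mathrm{span}\{g_{m,\mathfrak v}\},\qquad S_{\boldsymbol\lambda}\,g_{m,\mathfrak v}=\lambda_{v_{m+1}}\,g_{m+1,\mathfrak v},\quad m\in\mathbb Z,$$ where $\bigoplus$ denotes the orthogonal (Hilbert space) direct sum.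
   Context: $\mathbb N$ denotes the non-negative integers. A directed tree $\mathcal T=(V,\mathcal E)$ is a directed graph (no self-loops) that is connected as an undirected graph, has no directed circuits, and in which each vertex $v$ has at most one parent, i.e. vertex $u$ with $(u,v)\in\mathcal E$. It is rootless if every $v$ has a parent, denoted $\mathsf{par}(v)$. Put $\mathsf{Chi}(u)=\{v:(u,v)\in\mathcal E\}$; $\mathcal T$ is leafless if $\mathsf{Chi}(u)\neq\emptyset$ for all $u$. For $W\subseteq V$, $\mathsf{Chi}(W)=\bigcup_{u\in W}\mathsf{Chi}(u)$; $\mathsf{Chi}^{\langle 0\rangle}(v)=\{v\}$, $\mathsf{Chi}^{\langle n\rangle}(v)=\mathsf{Chi}(\mathsf{Chi}^{\langle n-1\rangle}(v))$ for $n\geq1$; $\mathsf{par}^{\langle n\rangle}$ is the $n$-fold composition of $\mathsf{par}$ (identity for $n=0$). A bilateral path is a family $\{v_m\}_{m\in\mathbb Z}$ with $v_0\in V$, $v_m=\mathsf{par}^{\langle -m\rangle}(v_0)$ for $m\leq-1$, and $v_m$ any but fixed element of $\mathsf{Chi}(v_{m-1})$ for $m\geq1$. $\ell^2(V)$ is the Hilbert space of square summable complex functions on $V$, with orthonormal basis $e_u$ = indicator function of $\{u\}$. The weighted shift is $(S_{\boldsymbol\lambda}f)(v)=\lambda_v f(\mathsf{par}(v))$, $v\in V$. Set $\boldsymbol\lambda^{(0)}(v)=1$ and $\boldsymbol\lambda^{(n)}(v)=\lambda_v\lambda_{\mathsf{par}(v)}\cdots\lambda_{\mathsf{par}^{\langle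 n-1\rangle}(v)}$ for $n\geq1$; $A(v,0)=\{v\}$ and $A(v,n)=\mathsf{Chi}^{\langle n\rangle}(\mathsf{par}^{\langle n\rangle}(v))\setminus\mathsf{Chi}^{\langle n-1\rangle}(\mathsf{par}^{\langle n-1\rangle}(v))$ for $n\geq1$; $\alpha_{\boldsymbol\lambda}(v)=\sum_{n=0}^\infty\sum_{u\in A(v,n)}\left(\frac{\boldsymbol\lambda^{(n)}(u)}{\boldsymbol\lambda^{(n)}(v)}\right)^2\in(0,\infty]$. The hyper-range of a bounded operator $T$ on $\mathcal H$ is $T^\infty(\mathcal H)=\bigcap_{n\geq0}T^n\mathcal H$. *)

theory Defs
  imports "HOL-Analysis.Analysis"
begin

section \<open>Directed trees\<close>

locale directed_tree =
  fixes V :: "'v set" and E :: "('v \<times> 'v) set"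
  assumes edges_in_vertices: "E \<subseteq> V \<times> V"
    and no_self_loops: "(u, v) \<in> E \<Longrightarrow> u \<noteq> v"
    and connected_undirected: "u \<in> V \<Longrightarrow> v \<in> V \<Longrightarrow> (u, v) \<in> (E \<union> E\<inverse>)\<^sup>*"
    and no_directed_circuits: "acyclic E"
    and parent_unique: "(u, v) \<in> E \<Longrightarrow> (u', v) \<in> E \<Longrightarrow> u = u'"

definition Chi :: "('v \<times> 'v) set \<Rightarrow> 'v \<Rightarrow> 'v set" where
  "Chi E u = {v. (u, v) \<in> E}"

definition Chi_pow :: "('v \<times> 'v) set \<Rightarrow> nat \<Rightarrow> 'v \<Rightarrow> 'v set" where
  "Chi_pow E n v = ((\<lambda>W. \<Union>u\<in>W. Chi E u) ^^ n) {v}"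

definition rootless :: "'v set \<Rightarrow> ('v \<times> 'v) set \<Rightarrow> bool" where
  "rootless V E \<longleftrightarrow> (\<forall>v\<in>V. \<exists>u. (u, v) \<in> E)"

definition leafless :: "'v set \<Rightarrow> ('v \<times> 'v) set \<Rightarrow> bool" where
  "leafless V E \<longleftrightarrow> (\<forall>u\<in>V. Chi E u \<noteq> {})"

definition par :: "('v \<times> 'v) set \<Rightarrow> 'v \<Rightarrow> 'v" where
  "par E v = (THE u. (u, v) \<in> E)"

definition bilateral_path :: "'v set \<Rightarrow> ('v \<times> 'v) set \<Rightarrow> (int \<Rightarrow> 'v) \<Rightarrow> bool" where
  "bilateral_path V E p \<longleftrightarrow>
     p 0 \<in> V \<and>
     (\<forall>m\<le>-1. p m = (par E ^^ nat (- m)) (p 0)) \<and>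
     (\<forall>m\<ge>1. p m \<in> Chi E (p (m - 1)))"


section \<open>The Hilbert space \<open>\<ell>\<^sup>2(V)\<close>\<close>

text \<open>
  Elements of \<open>\<ell>\<^sup>2(V)\<close> are functions on the whole type that vanish outside \<open>V\<close>, so that
  equality in \<open>\<ell>\<^sup>2(V)\<close> is equality of HOL functions.
\<close>

definition ell2 :: "'v set \<Rightarrow> ('v \<Rightarrow> complex) set" where
  "ell2 V = {f. (\<forall>v. v \<notin> V \<longrightarrow> f v = 0) \<and> (\<lambda>v. (cmod (f v))\<^sup>2) summable_on V}"

definition ell2_inner :: "'v set \<Rightarrow> ('v \<Rightarrow> complex) \<Rightarrow> ('v \<Rightarrow> complex) \<Rightarrow> complex" where
  "ell2_inner V f h = (\<Sum>\<^sub>\<infinity>v\<in>V. f v * cnj (h v))"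

definition ell2_norm :: "'v set \<Rightarrow> ('v \<Rightarrow> complex) \<Rightarrow> real" where
  "ell2_norm V f = sqrt (\<Sum>\<^sub>\<infinity>v\<in>V. (cmod (f v))\<^sup>2)"

definition basis_vec :: "'v \<Rightarrow> 'v \<Rightarrow> complex" where
  "basis_vec u = indicator {u}"

definition cspan :: "('v \<Rightarrow> complex) set \<Rightarrow> ('v \<Rightarrow> complex) set" where
  "cspan S = {\<lambda>w. \<Sum>a\<in>F. c a * a w | F c. finite F \<and> F \<subseteq> S}"

text \<open>
  Unconditional convergence in norm of \<open>\<Sum>i\<in>I. x i\<close> to \<open>f\<close>. The library relation \<open>has_sum\<close> on
  functions would refer to the topology of pointwise convergence instead.
\<close>

definition ell2_has_sum ::
  "'v set \<Rightarrow> ('i \<Rightarrow> 'v \<Rightarrow> complex) \<Rightarrow> 'i set \<Rightarrow> ('v \<Rightarrow> complex) \<Rightarrow> bool" where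
  "ell2_has_sum V x I f \<longleftrightarrow>
     ((\<lambda>F. ell2_norm V (\<lambda>w. (\<Sum>i\<in>F. x i w) - f w)) \<longlongrightarrow> 0) (finite_subsets_at_top I)"

definition is_orthogonal_direct_sum ::
  "'v set \<Rightarrow> 'i set \<Rightarrow> ('i \<Rightarrow> ('v \<Rightarrow> complex) set) \<Rightarrow> ('v \<Rightarrow> complex) set \<Rightarrow> bool" where
  "is_orthogonal_direct_sum V I M X \<longleftrightarrow>
     (\<forall>i\<in>I. M i \<subseteq> ell2 V) \<and>
     (\<forall>i\<in>I. \<forall>j\<in>I. i \<noteq> j \<longrightarrow> (\<forall>f\<in>M i. \<forall>h\<in>M j. ell2_inner V f h = 0)) \<and>
     X = {f \<in> ell2 V. \<exists>x. (\<forall>i\<in>I. x i \<in> M i) \<and> ell2_has_sum V x I f}"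


section \<open>Operators\<close>

definition bounded_operator ::
  "'v set \<Rightarrow> (('v \<Rightarrow> complex) \<Rightarrow> 'v \<Rightarrow> complex) \<Rightarrow> bool" where
  "bounded_operator V T \<longleftrightarrow>
     (\<forall>f\<in>ell2 V. T f \<in> ell2 V) \<and>
     (\<forall>f\<in>ell2 V. \<forall>h\<in>ell2 V. T (\<lambda>v. f v + h v) = (\<lambda>v. T f v + T h v)) \<and>
     (\<forall>c. \<forall>f\<in>ell2 V. T (\<lambda>v. c * f v) = (\<lambda>v. c * T f v)) \<and>
     (\<exists>C. \<forall>f\<in>ell2 V. ell2_norm V (T f) \<le> C * ell2_norm V f)"

definition left_invertible ::
  "'v set \<Rightarrow> (('v \<Rightarrow> complex) \<Rightarrow> 'v \<Rightarrow> complex) \<Rightarrow> bool" where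
  "left_invertible V T \<longleftrightarrow> (\<exists>L. bounded_operator V L \<and> (\<forall>f\<in>ell2 V. L (T f) = f))"

definition hyper_range ::
  "'v set \<Rightarrow> (('v \<Rightarrow> complex) \<Rightarrow> 'v \<Rightarrow> complex) \<Rightarrow> ('v \<Rightarrow> complex) set" where
  "hyper_range V T = (\<Inter>n. (T ^^ n) ` ell2 V)"

definition weighted_shift ::
  "'v set \<Rightarrow> ('v \<times> 'v) set \<Rightarrow> ('v \<Rightarrow> real) \<Rightarrow> ('v \<Rightarrow> complex) \<Rightarrow> 'v \<Rightarrow> complex" where
  "weighted_shift V E lam f = (\<lambda>v. if v \<in> V then of_real (lam v) * f (par E v) else 0)"


section \<open>The vectors spanning the hyper-range\<close>

definition lam_pow :: "('v \<times> 'v) set \<Rightarrow> ('v \<Rightarrow> real) \<Rightarrow> nat \<Rightarrow> 'v \<Rightarrow> real" where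
  "lam_pow E lam n v = (\<Prod>k<n. lam ((par E ^^ k) v))"

fun A_set :: "('v \<times> 'v) set \<Rightarrow> 'v \<Rightarrow> nat \<Rightarrow> 'v set" where
  "A_set E v 0 = {v}"
| "A_set E v (Suc n) =
     Chi_pow E (Suc n) ((par E ^^ Suc n) v) - Chi_pow E n ((par E ^^ n) v)"

definition alpha :: "('v \<times> 'v) set \<Rightarrow> ('v \<Rightarrow> real) \<Rightarrow> 'v \<Rightarrow> ennreal" where
  "alpha E lam v =
     (\<Sum>n. \<Sum>\<^sub>\<infinity>u\<in>A_set E v n. ennreal ((lam_pow E lam n u / lam_pow E lam n v)\<^sup>2))"

text \<open>
  The series is evaluated pointwise. At every \<open>w\<close> at most one of its terms is nonzero, as the
  sets \<open>A_set E v n\<close> are pairwise disjoint in \<open>n\<close>; so this is a genuine function on \<open>V\<close> whether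
  or not the series converges in \<open>\<ell>\<^sup>2(V)\<close>, and it is the sum in \<open>\<ell>\<^sup>2(V)\<close> if it does.
\<close>

definition g_vec ::
  "('v \<times> 'v) set \<Rightarrow> ('v \<Rightarrow> real) \<Rightarrow> (int \<Rightarrow> 'v) \<Rightarrow> int \<Rightarrow> 'v \<Rightarrow> complex" where
  "g_vec E lam p m =
     (if alpha E lam (p m) < \<infinity>
      then (\<lambda>w. \<Sum>n. \<Sum>\<^sub>\<infinity>u\<in>A_set E (p m) n.
              of_real (lam_pow E lam n u / lam_pow E lam n (p m)) * basis_vec u w)
      else (\<lambda>w. 0))"

end

theory Submission
  imports Defs
begin

text \<open>
  The \<open>n\<close>-th power of the weighted shift acts by
  \<open>(S\<^sup>n f) u = \<lambda>\<^sup>(\<^sup>n\<^sup>)(u) f (par\<^sup>n u)\<close>, so a function in its range is determined, up to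
  the factor \<open>\<lambda>\<^sup>(\<^sup>n\<^sup>)\<close>, by the \<open>n\<close>-th ancestor.  Call \<open>f\<close> \<^emph>\<open>coherent\<close> if
  \<open>f u / \<lambda>\<^sup>(\<^sup>n\<^sup>)(u) = f v / \<lambda>\<^sup>(\<^sup>n\<^sup>)(v)\<close> whenever \<open>u\<close> and \<open>v\<close> have the same \<open>n\<close>-th
  ancestor.  Members of the hyper-range are coherent.  Conversely a coherent \<open>f\<close> is \<open>S\<^sup>n h\<close> for an
  explicit function \<open>h\<close>, obtained by picking for each vertex some descendant in the \<open>n\<close>-th
  generation below it.  What remains to be seen is that \<open>h\<close> is square summable, and this is where
  left-invertibility enters.  It makes \<open>S\<close> bounded below, and \<open>\<bar>S t\<bar> \<le> \<bar>S h\<bar>\<close> holds pointwise for every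
  truncation \<open>t\<close> of \<open>h\<close> to a finite set, so \<open>h\<close> is square summable as soon as \<open>S h\<close> is
  (lemma \<open>ell2_if_shift_ell2\<close>).  Hence the hyper-range is exactly the set of coherent members
  of \<open>\<ell>\<^sup>2(V)\<close> (lemma \<open>hyper_range_eq_coherent\<close>).

  The tree decomposes into generations, two vertices being in the same one if their \<open>n\<close>-th ancestors
  agree for some \<open>n\<close>.  Every generation meets the bilateral path in exactly one vertex \<open>v\<^sub>m\<close>
  (lemma \<open>unique_path_vertex_in_generation\<close>), and on it a coherent function is determined by its
  value at \<open>v\<^sub>m\<close>: it is a multiple of \<open>u \<mapsto> \<lambda>\<^sup>(\<^sup>n\<^sup>)(u) / \<lambda>\<^sup>(\<^sup>n\<^sup>)(v\<^sub>m)\<close>.  The value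
  \<open>\<alpha>(v\<^sub>m)\<close> is the squared norm of this profile, so for square summable functions the multiple is zero unless
  \<open>\<alpha>(v\<^sub>m) < \<infinity>\<close>, in which case the profile is \<open>g\<^sub>m\<close>.  Splitting a coherent function
  along the generations, which are disjoint, gives the orthogonal decomposition.  Finally the shift maps the profile
  of \<open>v\<^sub>m\<close> to \<open>\<lambda>\<^sub>v\<close> times that of \<open>v = v\<^sub>m\<^sub>+\<^sub>1\<close>, and since it both preserves and reflects square
  summability, \<open>\<alpha>\<close> is finite at \<open>v\<^sub>m\<close> if and only if it is finite at \<open>v\<^sub>m\<^sub>+\<^sub>1\<close>.
\<close>

section \<open>Summation of nonnegative families\<close>

text \<open>
  A partial sum of the series is the sum over a finite union of the \<open>A n\<close>.  Conversely every finite
  subset of the whole union lies in such a finite union, so neither side can exceed the other.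
\<close>

lemma suminf_infsum_ennreal_disjoint:
  fixes f :: "'a \<Rightarrow> ennreal"
  assumes disj: "\<And>i j. i \<noteq> j \<Longrightarrow> A i \<inter> A j = {}"
  shows "(\<Sum>n::nat. infsum f (A n)) = infsum f (\<Union>n. A n)"
proof (rule antisym)
  have summable: "f summable_on B" for B by (simp add: nonneg_summable_on_complete)
  have part: "(\<Sum>n<N. infsum f (A n)) = infsum f (\<Union>n<N. A n)" for N
  proof (induction N)
    case (Suc N)
    have "A n \<inter> A N = {}" if "n < N" for n using disj that by simp
    then have "(\<Union>n<N. A n) \<inter> A N = {}" by blast
    then have "infsum f ((\<Union>n<N. A n) \<union> A N) = infsum f (\<Union>n<N. A n) + infsum f (A N)"
      by (rule infsum_Un_disjoint[OF summable summable])
    moreover have "(\<Union>n<Suc N. A n) = (\<Union>n<N. A n) \<union> A N"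
      by (auto simp: less_Suc_eq)
    ultimately show ?case using Suc.IH by simp
  qed simp
  show "(\<Sum>n. infsum f (A n)) \<le> infsum f (\<Union>n. A n)"
  proof (rule suminf_le_const)
    fix N
    have "infsum f (\<Union>n<N. A n) \<le> infsum f (\<Union>n. A n)"
      by (rule infsum_mono_neutral[OF summable summable]) auto
    then show "(\<Sum>n<N. infsum f (A n)) \<le> infsum f (\<Union>n. A n)" by (simp add: part)
  qed simp
  have "sum f F \<le> (\<Sum>n. infsum f (A n))" if F: "finite F" "F \<subseteq> (\<Union>n. A n)" for F
  proof -
    have "\<forall>x\<in>F. \<exists>n. x \<in> A n" using F by auto
    then obtain k where k: "\<And>x. x \<in> F \<Longrightarrow> x \<in> A (k x)" by metis
    define N where "N = Suc (Max (insert 0 (k ` F)))"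
    have "k x < N" if "x \<in> F" for x
      unfolding N_def less_Suc_eq_le using F that by (intro Max_ge) auto
    then have "F \<subseteq> (\<Union>n<N. A n)" using k by blast
    then have "infsum f F \<le> infsum f (\<Union>n<N. A n)"
      by (intro infsum_mono_neutral[OF summable summable]) auto
    also have "\<dots> = (\<Sum>n<N. infsum f (A n))" by (simp add: part)
    also have "\<dots> \<le> (\<Sum>n. infsum f (A n))" by (rule sum_le_suminf) auto
    finally show ?thesis using F by simp
  qed
  moreover have "infsum f (\<Union>n. A n) = (SUP F\<in>{F. finite F \<and> F \<subseteq> (\<Union>n. A n)}. sum f F)"
    by (rule nonneg_infsum_complete) simp
  ultimately show "infsum f (\<Union>n. A n) \<le> (\<Sum>n. infsum f (A n))"
    by (metis (no_types, lifting) SUP_least mem_Collect_eq)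
qed

lemma infsum_ennreal_finite_iff_summable:
  fixes f :: "'a \<Rightarrow> real"
  assumes nonneg: "\<And>x. x \<in> A \<Longrightarrow> f x \<ge> 0"
  shows "infsum (\<lambda>x. ennreal (f x)) A < \<infinity> \<longleftrightarrow> f summable_on A"
proof -
  have sum_F: "(\<Sum>x\<in>F. ennreal (f x)) = ennreal (sum f F)" if "F \<subseteq> A" for F
    using that nonneg by (intro sum_ennreal) auto
  have SUP: "infsum (\<lambda>x. ennreal (f x)) A = (SUP F\<in>{F. finite F \<and> F \<subseteq> A}. ennreal (sum f F))"
    by (simp add: nonneg_infsum_complete sum_F cong: SUP_cong_simp)
  show ?thesis
  proof
    assume "infsum (\<lambda>x. ennreal (f x)) A < \<infinity>"
    then obtain r where r: "r \<ge> 0" "infsum (\<lambda>x. ennreal (f x)) A = ennreal r"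
      by (cases "infsum (\<lambda>x. ennreal (f x)) A") auto
    have "sum f F \<le> r" if "finite F" "F \<subseteq> A" for F
    proof -
      have "ennreal (sum f F) \<le> ennreal r"
        using that unfolding r(2)[symmetric] SUP by (intro SUP_upper) auto
      then show ?thesis using r by simp
    qed
    then show "f summable_on A"
      using nonneg by (intro nonneg_bdd_above_summable_on bdd_aboveI[where M=r]) auto
  next
    assume "f summable_on A"
    then show "infsum (\<lambda>x. ennreal (f x)) A < \<infinity>"
      using infsum_nonneg_is_SUPREMUM_ennreal[of f A] nonneg SUP by (metis ennreal_less_top infinity_ennreal_def)
  qed
qed


section \<open>Square summable functions\<close>

lemma ell2_norm_nonneg: "ell2_norm V f \<ge> 0"
  by (simp add: ell2_norm_def infsum_nonneg)

lemma ell2_summable: "f \<in> ell2 V \<Longrightarrow> (\<lambda>v. (cmod (f v))\<^sup>2) summable_on V"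
  by (simp add: ell2_def)

lemma ell2_dominated:
  assumes "h \<in> ell2 V" "\<And>v. v \<in> V \<Longrightarrow> cmod (f v) \<le> cmod (h v)" "\<And>v. v \<notin> V \<Longrightarrow> f v = 0"
  shows "f \<in> ell2 V" "ell2_norm V f \<le> ell2_norm V h"
proof -
  have le: "(cmod (f v))\<^sup>2 \<le> (cmod (h v))\<^sup>2" if "v \<in> V" for v
    using assms(2)[OF that] by (simp add: power_mono)
  have sum: "(\<lambda>v. (cmod (f v))\<^sup>2) summable_on V"
    using ell2_summable[OF assms(1)] le by (rule summable_on_comparison_test) auto
  then show "f \<in> ell2 V" using assms(3) by (simp add: ell2_def)
  show "ell2_norm V f \<le> ell2_norm V h"
    unfolding ell2_norm_def
    using sum ell2_summable[OF assms(1)] le by (intro real_sqrt_le_mono infsum_mono)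
qed

lemma ell2_scale:
  assumes "f \<in> ell2 V"
  shows "(\<lambda>v. c * f v) \<in> ell2 V"
  using assms summable_on_cmult_right[of "\<lambda>v. (cmod (f v))\<^sup>2" V "(cmod c)\<^sup>2"]
  by (auto simp: ell2_def norm_mult power_mult_distrib)

lemma ell2_add:
  assumes "f \<in> ell2 V" "h \<in> ell2 V"
  shows "(\<lambda>v. f v + h v) \<in> ell2 V"
proof -
  have "(\<lambda>v. 2 * (cmod (f v))\<^sup>2 + 2 * (cmod (h v))\<^sup>2) summable_on V"
    using assms by (intro summable_on_add summable_on_cmult_right ell2_summable)
  moreover have "(cmod (f v + h v))\<^sup>2 \<le> 2 * (cmod (f v))\<^sup>2 + 2 * (cmod (h v))\<^sup>2" for v
  proof -
    have "(cmod (f v + h v))\<^sup>2 \<le> (cmod (f v) + cmod (h v))\<^sup>2"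
      by (intro power_mono norm_triangle_ineq) auto
    also have "\<dots> \<le> 2 * (cmod (f v))\<^sup>2 + 2 * (cmod (h v))\<^sup>2"
      using sum_squares_bound[of "cmod (f v)" "cmod (h v)"] by (simp add: power2_sum)
    finally show ?thesis .
  qed
  ultimately have "(\<lambda>v. (cmod (f v + h v))\<^sup>2) summable_on V"
    by (rule summable_on_comparison_test) auto
  then show ?thesis using assms by (simp add: ell2_def)
qed

lemma zero_in_ell2: "(\<lambda>v. 0) \<in> ell2 V"
  by (simp add: ell2_def)

lemma ell2_sum:
  assumes "finite F" "\<And>i. i \<in> F \<Longrightarrow> x i \<in> ell2 V"
  shows "(\<lambda>v. \<Sum>i\<in>F. x i v) \<in> ell2 V"
  using assms by (induction F rule: finite_induct) (auto intro: zero_in_ell2 ell2_add)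

lemma ell2_minus: "f \<in> ell2 V \<Longrightarrow> h \<in> ell2 V \<Longrightarrow> (\<lambda>v. f v - h v) \<in> ell2 V"
  using ell2_add[of f V "\<lambda>v. -1 * h v"] ell2_scale[of h V "-1"] by simp

lemma cmod_le_ell2_norm:
  assumes "f \<in> ell2 V" "v \<in> V"
  shows "cmod (f v) \<le> ell2_norm V f"
proof -
  have "(\<Sum>u\<in>{v}. (cmod (f u))\<^sup>2) \<le> (\<Sum>\<^sub>\<infinity>u\<in>V. (cmod (f u))\<^sup>2)"
    using assms by (intro finite_sum_le_infsum ell2_summable) auto
  then show ?thesis unfolding ell2_norm_def by (intro real_le_rsqrt) simp
qed

text \<open>
  Convergence in norm implies convergence at every point, and at \<open>v\<close> the partial sums are
  constant as soon as they contain the index \<open>j\<close>.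
\<close>

lemma ell2_has_sum_value_at_single_index:
  assumes sum: "ell2_has_sum V x I f"
    and f: "f \<in> ell2 V" and x: "\<And>i. i \<in> I \<Longrightarrow> x i \<in> ell2 V"
    and v: "v \<in> V" and j: "j \<in> I" and single: "\<And>i. i \<in> I \<Longrightarrow> i \<noteq> j \<Longrightarrow> x i v = 0"
  shows "f v = x j v"
proof -
  have "\<forall>\<^sub>F F in finite_subsets_at_top I. finite F \<and> {j} \<subseteq> F \<and> F \<subseteq> I"
    unfolding eventually_finite_subsets_at_top using j by (intro exI[of _ "{j}"]) auto
  then have "\<forall>\<^sub>F F in finite_subsets_at_top I.
      cmod (x j v - f v) \<le> ell2_norm V (\<lambda>w. (\<Sum>i\<in>F. x i w) - f w)"
  proof (eventually_elim)
    case (elim F)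
    then have "(\<Sum>i\<in>F. x i v) = (\<Sum>i\<in>{j}. x i v)"
      using single by (intro sum.mono_neutral_right) auto
    moreover have "(\<lambda>w. (\<Sum>i\<in>F. x i w) - f w) \<in> ell2 V"
      using elim x f by (intro ell2_minus ell2_sum) auto
    ultimately show ?case using cmod_le_ell2_norm[OF _ v] by fastforce
  qed
  then have "cmod (x j v - f v) \<le> 0"
    using sum unfolding ell2_has_sum_def
    by (intro tendsto_lowerbound[of _ 0 "finite_subsets_at_top I"]) auto
  then show ?thesis by simp
qed

text \<open>
  The labels \<open>l\<close> cut \<open>V\<close> into fibres.  A finite set of vertices carrying all but \<open>e\<close> of the
  squared norm meets only finitely many fibres, and the pieces of \<open>f\<close> on these already sum to \<open>f\<close> up
  to an error of squared norm less than \<open>e\<close>.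
\<close>

lemma ell2_has_sum_partition:
  assumes f: "f \<in> ell2 V"
  shows "ell2_has_sum V (\<lambda>i v. if l v = i then f v else 0) UNIV f"
proof -
  let ?q = "\<lambda>v. (cmod (f v))\<^sup>2"
  let ?d = "\<lambda>F v. (\<Sum>i\<in>F. if l v = i then f v else 0) - f v"
  have d: "?d F v = (if l v \<in> F then 0 else - f v)" if "finite F" for F v
    using that by simp
  have "((\<lambda>F. infsum (\<lambda>v. (cmod (?d F v))\<^sup>2) V) \<longlongrightarrow> 0) (finite_subsets_at_top UNIV)"
  proof (rule tendstoI)
    fix e :: real assume "e > 0"
    then have "\<forall>\<^sub>F K in finite_subsets_at_top V. dist (sum ?q K) (infsum ?q V) < e"
      using infsum_tendsto[OF ell2_summable[OF f]] by (rule tendstoD[rotated])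
    then obtain K where K: "finite K" "K \<subseteq> V" "dist (sum ?q K) (infsum ?q V) < e"
      unfolding eventually_finite_subsets_at_top by blast
    have "dist (infsum (\<lambda>v. (cmod (?d F v))\<^sup>2) V) 0 < e" if F: "finite F" "l ` K \<subseteq> F" for F
    proof -
      have "infsum (\<lambda>v. (cmod (?d F v))\<^sup>2) V \<le> infsum ?q (V - K)"
      proof (rule infsum_mono_neutral)
        have "?d F \<in> ell2 V"
          using f by (rule ell2_dominated) (use f F in \<open>auto simp: d ell2_def\<close>)
        then show "(\<lambda>v. (cmod (?d F v))\<^sup>2) summable_on V" by (rule ell2_summable)
        show "?q summable_on (V - K)"
          using ell2_summable[OF f] by (rule summable_on_subset_banach) auto
      qed (use F in \<open>auto simp: d\<close>)
      also have "\<dots> = infsum ?q V - sum ?q K"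
        using K ell2_summable[OF f] by (simp add: infsum_Diff)
      also have "\<dots> < e" using K by (simp add: dist_real_def)
      finally show ?thesis by (simp add: infsum_nonneg)
    qed
    then show "\<forall>\<^sub>F F in finite_subsets_at_top UNIV.
        dist (infsum (\<lambda>v. (cmod (?d F v))\<^sup>2) V) 0 < e"
      unfolding eventually_finite_subsets_at_top using K by (intro exI[of _ "l ` K"]) auto
  qed
  from tendsto_real_sqrt[OF this] show ?thesis
    by (simp add: ell2_has_sum_def ell2_norm_def)
qed

lemma cspan_singleton: "cspan {a} = {\<lambda>w. c * a w | c. True}"
proof -
  have "\<exists>c'. (\<lambda>w. \<Sum>b\<in>F. c b * b w) = (\<lambda>w. c' * a w)" if "F \<subseteq> {a}" for F c
  proof -
    have "F = {} \<or> F = {a}" using that by auto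
    then show ?thesis
    proof
      assume "F = {}" then show ?thesis by (intro exI[of _ 0]) simp
    next
      assume "F = {a}" then show ?thesis by (intro exI[of _ "c a"]) simp
    qed
  qed
  moreover have "\<exists>F c'. (\<lambda>w. c * a w) = (\<lambda>w. \<Sum>b\<in>F. c' b * b w) \<and> finite F \<and> F \<subseteq> {a}" for c
    by (intro exI[of _ "{a}"] exI[of _ "\<lambda>_. c"]) simp
  ultimately show ?thesis unfolding cspan_def by blast
qed


section \<open>Ancestors and generations\<close>

locale rootless_directed_tree = directed_tree V E for V :: "'v set" and E :: "('v \<times> 'v) set" +
  assumes rootless: "rootless V E"
begin

abbreviation anc :: "nat \<Rightarrow> 'v \<Rightarrow> 'v" where
  "anc n \<equiv> par E ^^ n"

definition gen :: "'v \<Rightarrow> 'v set" where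
  "gen v = {u\<in>V. \<exists>n. anc n u = anc n v}"

lemma par_eq: "(u, v) \<in> E \<Longrightarrow> par E v = u"
  unfolding par_def using parent_unique by blast

lemma par_edge: "v \<in> V \<Longrightarrow> (par E v, v) \<in> E"
  using rootless par_eq unfolding rootless_def by blast

lemma par_in_V: "v \<in> V \<Longrightarrow> par E v \<in> V"
  using par_edge edges_in_vertices by blast

lemma anc_in_V: "v \<in> V \<Longrightarrow> anc n v \<in> V"
  by (induction n) (auto simp: par_in_V)

lemma anc_anc: "anc m (anc n v) = anc (m + n) v"
  by (simp add: funpow_add)

lemma anc_Suc: "anc (Suc n) v = anc n (par E v)"
  by (simp add: funpow_swap1)

lemma anc_eq_mono:
  assumes "anc n u = anc n v" "n \<le> k"
  shows "anc k u = anc k v"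
proof -
  have "anc k w = anc (k - n) (anc n w)" for w
    using assms(2) by (simp add: anc_anc)
  then show ?thesis using assms(1) by simp
qed

lemma Chi_iff: "v \<in> Chi E u \<longleftrightarrow> v \<in> V \<and> par E v = u"
  using par_edge par_eq edges_in_vertices by (auto simp: Chi_def)

lemma Chi_pow_iff: "u \<in> V \<Longrightarrow> v \<in> Chi_pow E n u \<longleftrightarrow> v \<in> V \<and> anc n v = u"
proof (induction n arbitrary: v)
  case (Suc n)
  have "Chi_pow E (Suc n) u = (\<Union>w\<in>Chi_pow E n u. Chi E w)"
    by (simp add: Chi_pow_def)
  then have "v \<in> Chi_pow E (Suc n) u \<longleftrightarrow> (\<exists>w\<in>V. anc n w = u \<and> v \<in> V \<and> par E v = w)"
    using Suc by (auto simp: Chi_iff)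
  then show ?case using par_in_V by (auto simp: anc_Suc simp del: funpow.simps)
qed (auto simp: Chi_pow_def)

text \<open>
  Ancestors that agree at one step agree at every later one.  Removing the vertices whose
  ancestors agree with those of \<open>v\<close> at step \<open>n - 1\<close> therefore removes all that agree at any earlier step.
\<close>

lemma A_set_iff:
  assumes v: "v \<in> V"
  shows "u \<in> A_set E v n \<longleftrightarrow> u \<in> V \<and> anc n u = anc n v \<and> (\<forall>k<n. anc k u \<noteq> anc k v)"
proof (cases n)
  case (Suc m)
  have "u \<in> A_set E v n \<longleftrightarrow> u \<in> V \<and> anc n u = anc n v \<and> anc m u \<noteq> anc m v"
    using Suc by (auto simp: Chi_pow_iff anc_in_V[OF v] simp del: funpow.simps)
  moreover have "anc m u \<noteq> anc m v \<longleftrightarrow> (\<forall>k<n. anc k u \<noteq> anc k v)"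
    using anc_eq_mono[of _ u v m] Suc by (auto simp: less_Suc_eq_le)
  ultimately show ?thesis by blast
qed (use v in auto)

lemma A_set_disjoint: "v \<in> V \<Longrightarrow> i \<noteq> j \<Longrightarrow> A_set E v i \<inter> A_set E v j = {}"
  by (metis (no_types, lifting) A_set_iff disjoint_iff linorder_neqE_nat)

lemma UN_A_set: "v \<in> V \<Longrightarrow> (\<Union>n. A_set E v n) = gen v"
proof -
  assume v: "v \<in> V"
  have "\<exists>n. u \<in> A_set E v n" if "u \<in> gen v" for u
  proof -
    obtain n where "anc n u = anc n v" using \<open>u \<in> gen v\<close> by (auto simp: gen_def)
    then have "u \<in> A_set E v (LEAST n. anc n u = anc n v)"
      using v that by (auto simp: A_set_iff gen_def intro: LeastI dest: not_less_Least)
    then show ?thesis ..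
  qed
  moreover have "u \<in> gen v" if "u \<in> A_set E v n" for u n
    using v that by (auto simp: A_set_iff gen_def)
  ultimately show ?thesis by blast
qed

lemma anc_inj:
  assumes v: "v \<in> V" and eq: "anc m v = anc n v"
  shows "m = n"
proof -
  have path: "w \<in> V \<Longrightarrow> (anc (Suc k) w, w) \<in> E\<^sup>+" for k w
  proof (induction k)
    case (Suc k)
    have "(anc (Suc (Suc k)) w, anc (Suc k) w) \<in> E"
      using par_edge[OF anc_in_V[OF Suc.prems, of "Suc k"]] by simp
    with Suc show ?case by (meson trancl.trancl_into_trancl trancl_into_trancl2)
  qed (auto intro: par_edge)
  have False if "i < j" "anc i v = anc j v" for i j
  proof -
    have "anc j v = anc (Suc (j - i - 1)) (anc i v)"
      unfolding anc_anc using that by simp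
    then have "(anc i v, anc i v) \<in> E\<^sup>+"
      using path[OF anc_in_V[OF v]] that by metis
    then show False using no_directed_circuits by (auto simp: acyclic_def)
  qed
  then show ?thesis using eq by (metis linorder_neqE_nat)
qed

text \<open>
  Along an undirected walk starting at \<open>u\<close>, each step lengthens one of the two lines of ancestors by one.
\<close>

lemma common_ancestor:
  assumes "u \<in> V" "v \<in> V"
  shows "\<exists>i j. anc i u = anc j v"
proof -
  have "(u, v) \<in> (E \<union> E\<inverse>)\<^sup>*" using assms connected_undirected by blast
  then show ?thesis
  proof (induction rule: rtrancl_induct)
    case base
    show ?case by blast
  next
    case (step y z)
    then obtain i j where ij: "anc i u = anc j y" by blast
    from step(2) show ?case
    proof
      assume "(y, z) \<in> E"
      then have "anc i u = anc (Suc j) z" using ij par_eq by (simp add: anc_Suc del: funpow.simps)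
      then show ?thesis by blast
    next
      assume "(y, z) \<in> E\<inverse>"
      then have "anc (Suc i) u = anc j z"
        using ij par_eq[of z y] by (metis anc_Suc converseD funpow.simps(2) comp_apply)
      then show ?thesis by blast
    qed
  qed
qed

lemma gen_iff_of_anc_eq:
  assumes "u \<in> V" "w \<in> V" "anc n u = anc n w"
  shows "u \<in> gen v \<longleftrightarrow> w \<in> gen v"
proof -
  have "w' \<in> gen v" if "u' \<in> gen v" "w' \<in> V" "anc n u' = anc n w'" for u' w'
  proof -
    obtain k where "anc k u' = anc k v" using \<open>u' \<in> gen v\<close> by (auto simp: gen_def)
    then have "anc (max k n) w' = anc (max k n) v"
      using that anc_eq_mono[of k u' v "max k n"] anc_eq_mono[of n u' w' "max k n"] by simp
    then show ?thesis using that by (auto simp: gen_def)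
  qed
  from this[of u w] this[of w u] assms show ?thesis by metis
qed

lemma gen_par_iff:
  assumes "w \<in> V"
  shows "w \<in> gen v \<longleftrightarrow> par E w \<in> gen (par E v)"
proof
  assume "w \<in> gen v"
  then obtain n where "anc n w = anc n v" by (auto simp: gen_def)
  then have "anc (Suc n) w = anc (Suc n) v" by simp
  then show "par E w \<in> gen (par E v)"
    using assms par_in_V by (auto simp: gen_def anc_Suc simp del: funpow.simps)
next
  assume "par E w \<in> gen (par E v)"
  then obtain n where "anc n (par E w) = anc n (par E v)" by (auto simp: gen_def)
  then have "anc (Suc n) w = anc (Suc n) v" by (simp add: anc_Suc del: funpow.simps)
  then show "w \<in> gen v" unfolding gen_def using assms by blast
qed

end

locale rootless_tree_with_path = rootless_directed_tree V E
  for V :: "'v set" and E :: "('v \<times> 'v) set" +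
  fixes p :: "int \<Rightarrow> 'v"
  assumes path: "bilateral_path V E p"
begin

lemma path_in_V: "p m \<in> V"
proof (cases "m \<le> -1")
  case True
  then have "p m = anc (nat (-m)) (p 0)" "p 0 \<in> V" using path by (auto simp: bilateral_path_def)
  then show ?thesis by (simp add: anc_in_V)
next
  case False
  show ?thesis
  proof (cases "m = 0")
    case True
    then show ?thesis using path by (simp add: bilateral_path_def)
  next
    assume "m \<noteq> 0"
    then have "p m \<in> Chi E (p (m - 1))" using path False by (auto simp: bilateral_path_def)
    then show ?thesis by (simp add: Chi_iff)
  qed
qed

lemma par_path: "par E (p m) = p (m - 1)"
proof (cases "m \<ge> 1")
  case True
  then have "p m \<in> Chi E (p (m - 1))" using path by (auto simp: bilateral_path_def)
  then show ?thesis by (simp add: Chi_iff)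
next
  case False
  have neg: "p k = anc (nat (-k)) (p 0)" if "k \<le> 0" for k
    using that path by (cases "k = 0") (auto simp: bilateral_path_def)
  have "nat (- (m - 1)) = Suc (nat (-m))" using False by simp
  then show ?thesis using neg[of m] neg[of "m - 1"] False by simp
qed

lemma anc_path: "anc n (p m) = p (m - int n)"
  by (induction n) (auto simp: par_path algebra_simps)

lemma path_inj:
  assumes "p a = p b"
  shows "a = b"
proof -
  have neq: False if "p a = p b" "a < b" for a b
  proof -
    have "anc (nat (b - a)) (p b) = anc 0 (p b)" using that by (simp add: anc_path)
    then have "nat (b - a) = 0" by (rule anc_inj[OF path_in_V])
    then show False using that by simp
  qed
  show ?thesis
    using assms neq[of a b] neq[of b a] by (cases a b rule: linorder_cases) simp_all
qed

text \<open>
  If \<open>i\<close> steps up from \<open>u\<close> lead to the same vertex as \<open>j\<close> steps up from \<open>v\<^sub>0\<close>, then \<open>u\<close> is in the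
  generation of \<open>v\<^sub>m\<close> for \<open>m = i - j\<close>; acyclicity makes \<open>m\<close> independent of the choice.
\<close>

lemma unique_path_vertex_in_generation:
  assumes u: "u \<in> V"
  shows "\<exists>!m. u \<in> gen (p m)"
proof (rule ex_ex1I)
  obtain i j where "anc i u = anc j (p 0)" using common_ancestor[OF u path_in_V] by blast
  then have "anc i u = anc i (p (int i - int j))" by (simp add: anc_path)
  then show "\<exists>m. u \<in> gen (p m)" using u by (auto simp: gen_def)
next
  fix a b assume "u \<in> gen (p a)" "u \<in> gen (p b)"
  then obtain i j where "anc i u = anc i (p a)" "anc j u = anc j (p b)" by (auto simp: gen_def)
  then have "anc (max i j) (p a) = anc (max i j) (p b)"
    using anc_eq_mono[of i u _ "max i j"] anc_eq_mono[of j u _ "max i j"] by simp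
  then show "a = b" unfolding anc_path using path_inj by fastforce
qed

end


section \<open>Powers of the shift and its hyper-range\<close>

locale weighted_tree = rootless_directed_tree V E
  for V :: "'v set" and E :: "('v \<times> 'v) set" +
  fixes lam :: "'v \<Rightarrow> real"
  assumes lam_pos: "v \<in> V \<Longrightarrow> lam v > 0"
begin

abbreviation S :: "('v \<Rightarrow> complex) \<Rightarrow> 'v \<Rightarrow> complex" where
  "S \<equiv> weighted_shift V E lam"

abbreviation lpow :: "nat \<Rightarrow> 'v \<Rightarrow> real" where
  "lpow \<equiv> lam_pow E lam"

definition coherent :: "('v \<Rightarrow> complex) \<Rightarrow> bool" where
  "coherent f \<longleftrightarrow> (\<forall>n. \<forall>u\<in>V. \<forall>v\<in>V. anc n u = anc n v \<longrightarrow>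
     of_real (lpow n v) * f u = of_real (lpow n u) * f v)"

lemma lpow_pos: "v \<in> V \<Longrightarrow> lpow n v > 0"
  unfolding lam_pow_def by (intro prod_pos) (simp add: lam_pos anc_in_V)

lemma lpow_add: "lpow (n + k) v = lpow n v * lpow k (anc n v)"
  by (induction k) (simp_all add: lam_pow_def lessThan_Suc funpow_add[symmetric] add.commute
      anc_anc[unfolded comp_def] mult.left_commute mult.commute)

lemma lpow_Suc: "lpow (Suc n) v = lam v * lpow n (par E v)"
  using lpow_add[of 1 n v] by (simp add: lam_pow_def)

lemma shift_pow:
  assumes "\<And>v. v \<notin> V \<Longrightarrow> f v = 0"
  shows "(S ^^ n) f v = (if v \<in> V then of_real (lpow n v) * f (anc n v) else 0)"
proof (induction n arbitrary: v)
  case 0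
  then show ?case using assms by (simp add: lam_pow_def)
next
  case (Suc n)
  have "(S ^^ Suc n) f v = (if v \<in> V then of_real (lam v) * (S ^^ n) f (par E v) else 0)"
    by (simp add: weighted_shift_def)
  then show ?case using Suc par_in_V
    by (simp add: lpow_Suc anc_Suc mult.assoc del: funpow.simps)
qed

end

locale left_invertible_shift = weighted_tree V E lam
  for V :: "'v set" and E :: "('v \<times> 'v) set" and lam :: "'v \<Rightarrow> real" +
  assumes bounded: "bounded_operator V (weighted_shift V E lam)"
    and left_inv: "left_invertible V (weighted_shift V E lam)"
    and leafless: "leafless V E"
begin

lemma shift_in_ell2: "f \<in> ell2 V \<Longrightarrow> S f \<in> ell2 V"
  using bounded by (simp add: bounded_operator_def)

lemma shift_bounded_below:
  obtains C where "C \<ge> 0" "\<And>f. f \<in> ell2 V \<Longrightarrow> ell2_norm V f \<le> C * ell2_norm V (S f)"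
proof -
  obtain L C where LC: "\<And>f. f \<in> ell2 V \<Longrightarrow> L (S f) = f"
    "\<And>f. f \<in> ell2 V \<Longrightarrow> ell2_norm V (L f) \<le> C * ell2_norm V f"
    using left_inv unfolding left_invertible_def bounded_operator_def by metis
  have "ell2_norm V f \<le> \<bar>C\<bar> * ell2_norm V (S f)" if "f \<in> ell2 V" for f
  proof -
    have "ell2_norm V f \<le> C * ell2_norm V (S f)"
      using LC(1)[OF that] LC(2)[OF shift_in_ell2[OF that]] by simp
    also have "\<dots> \<le> \<bar>C\<bar> * ell2_norm V (S f)"
      by (intro mult_right_mono ell2_norm_nonneg) auto
    finally show ?thesis .
  qed
  then show thesis using that[of "\<bar>C\<bar>"] by simp
qed

text \<open>
  The truncation of \<open>h\<close> to a finite set \<open>F\<close> is square summable, and its image is dominated pointwise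
  by \<open>S h\<close>.  As \<open>S\<close> is bounded below, the norms of all truncations are bounded by a multiple of the
  norm of \<open>S h\<close>.
\<close>

lemma ell2_if_shift_ell2:
  assumes h0: "\<And>v. v \<notin> V \<Longrightarrow> h v = 0" and Sh: "S h \<in> ell2 V"
  shows "h \<in> ell2 V"
proof -
  obtain C where C: "C \<ge> 0" "\<And>f. f \<in> ell2 V \<Longrightarrow> ell2_norm V f \<le> C * ell2_norm V (S f)"
    using shift_bounded_below by blast
  define B where "B = C * ell2_norm V (S h)"
  have "(\<Sum>v\<in>F. (cmod (h v))\<^sup>2) \<le> B\<^sup>2" if F: "F \<subseteq> V" "finite F" for F
  proof -
    define t where "t = (\<lambda>v. if v \<in> F then h v else 0)"
    have t_sum: "((\<lambda>v. (cmod (t v))\<^sup>2) has_sum (\<Sum>v\<in>F. (cmod (h v))\<^sup>2)) V"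
      using has_sum_cong_neutral[of V F "\<lambda>v. (cmod (t v))\<^sup>2" "\<lambda>v. (cmod (h v))\<^sup>2"]
        has_sum_finite[OF F(2), of "\<lambda>v. (cmod (h v))\<^sup>2"]
        has_sum_cong_neutral[of F V "\<lambda>v. (cmod (t v))\<^sup>2" "\<lambda>v. (cmod (h v))\<^sup>2"] F(1)
      by (auto simp: t_def)
    have t: "t \<in> ell2 V"
      using t_sum F by (auto simp: ell2_def t_def dest: has_sum_imp_summable)
    have "sqrt (\<Sum>v\<in>F. (cmod (h v))\<^sup>2) = ell2_norm V t"
      using infsumI[OF t_sum] by (simp add: ell2_norm_def)
    also have "\<dots> \<le> C * ell2_norm V (S t)" using C t by blast
    also have "\<dots> \<le> B"
      unfolding B_def using C(1) Sh
      by (intro mult_left_mono ell2_dominated(2)) (auto simp: weighted_shift_def t_def)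
    finally have "sqrt (\<Sum>v\<in>F. (cmod (h v))\<^sup>2) \<le> B" .
    then show ?thesis by (rule sqrt_le_D)
  qed
  then have "(\<lambda>v. (cmod (h v))\<^sup>2) summable_on V"
    by (intro nonneg_bdd_above_summable_on bdd_aboveI[where M="B\<^sup>2"]) auto
  then show ?thesis using h0 by (simp add: ell2_def)
qed

lemma ell2_if_shift_pow_ell2:
  assumes h0: "\<And>v. v \<notin> V \<Longrightarrow> h v = 0" and Sh: "(S ^^ n) h \<in> ell2 V"
  shows "h \<in> ell2 V"
  using Sh
proof (induction n)
  case (Suc n)
  have "(S ^^ n) h \<in> ell2 V"
  proof (rule ell2_if_shift_ell2)
    show "S ((S ^^ n) h) \<in> ell2 V" using Suc.prems by simp
  qed (simp add: shift_pow[OF h0])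
  then show ?case by (rule Suc.IH)
qed simp

lemma descendant_exists: "w \<in> V \<Longrightarrow> \<exists>v\<in>V. anc n v = w"
proof (induction n)
  case (Suc n)
  then obtain v where v: "v \<in> V" "anc n v = w" by blast
  then obtain c where "c \<in> Chi E v" using leafless by (auto simp: leafless_def)
  then have "c \<in> V" "anc (Suc n) c = w" using v by (auto simp: Chi_iff anc_Suc simp del: funpow.simps)
  then show ?case by blast
qed auto

text \<open>
  A coherent function can be pulled back along \<open>n\<close> steps to a function on the vertices, dividing its value at
  any \<open>n\<close>-th descendant by the corresponding \<open>\<lambda>\<^sup>(\<^sup>n\<^sup>)\<close>; square summability of the result is supplied by the lower bound on the shift.
\<close>

lemma hyper_range_eq_coherent: "hyper_range V S = {f \<in> ell2 V. coherent f}"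
proof (intro equalityI subsetI)
  fix f assume f: "f \<in> hyper_range V S"
  have "\<exists>h\<in>ell2 V. f = (S ^^ n) h" for n using f by (auto simp: hyper_range_def)
  then obtain h where h: "\<And>n. h n \<in> ell2 V" "\<And>n. f = (S ^^ n) (h n)" by metis
  have f_eq: "f u = of_real (lpow n u) * h n (anc n u)" if "u \<in> V" for u n
  proof -
    have "f u = (S ^^ n) (h n) u" using h(2) by metis
    also have "\<dots> = of_real (lpow n u) * h n (anc n u)"
      using that h(1)[of n] by (subst shift_pow) (auto simp: ell2_def)
    finally show ?thesis .
  qed
  have "coherent f" unfolding coherent_def
  proof (intro allI ballI impI)
    fix n u v assume "u \<in> V" "v \<in> V" "anc n u = anc n v"
    then show "of_real (lpow n v) * f u = of_real (lpow n u) * f v"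
      using f_eq[of u n] f_eq[of v n] by simp
  qed
  moreover have "f \<in> ell2 V" using h(1)[of 0] h(2)[of 0] by simp
  ultimately show "f \<in> {f \<in> ell2 V. coherent f}" by simp
next
  fix f assume "f \<in> {f \<in> ell2 V. coherent f}"
  then have f: "f \<in> ell2 V" and coh: "coherent f" by auto
  have "f \<in> (S ^^ n) ` ell2 V" for n
  proof -
    obtain d where d: "\<And>w. w \<in> V \<Longrightarrow> d w \<in> V \<and> anc n (d w) = w"
      using descendant_exists[of _ n] by metis
    \<comment> \<open>By coherence the value does not depend on the descendant \<open>d w\<close> picked here.\<close>
    define h where "h = (\<lambda>w. if w \<in> V then f (d w) / of_real (lpow n (d w)) else 0)"
    have h0: "h v = 0" if "v \<notin> V" for v using that by (simp add: h_def)
    have "(S ^^ n) h v = f v" for v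
    proof (cases "v \<in> V")
      case True
      let ?w = "d (anc n v)"
      have w: "?w \<in> V" "anc n v = anc n ?w" using d anc_in_V[OF True] by auto
      then have "of_real (lpow n ?w) * f v = of_real (lpow n v) * f ?w"
        using coh True unfolding coherent_def by blast
      then have "of_real (lpow n v) * h (anc n v) = f v"
        using True anc_in_V[OF True] lpow_pos[OF w(1), of n] by (simp add: h_def field_simps)
      then show ?thesis using True by (simp add: shift_pow[OF h0])
    next
      case False
      then show ?thesis using f by (simp add: shift_pow[OF h0] ell2_def)
    qed
    then have Sh: "(S ^^ n) h = f" by blast
    have "h \<in> ell2 V"
    proof (rule ell2_if_shift_pow_ell2[where n = n])
      show "(S ^^ n) h \<in> ell2 V" using f Sh by simp
    qed (rule h0)
    then show ?thesis using Sh by blast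
  qed
  then show "f \<in> hyper_range V S" by (auto simp: hyper_range_def)
qed

end


section \<open>The profile of a generation\<close>

context weighted_tree
begin

text \<open>
  This is the function \<open>u \<mapsto> \<lambda>\<^sup>(\<^sup>n\<^sup>)(u) / \<lambda>\<^sup>(\<^sup>n\<^sup>)(v)\<close> on the generation of \<open>v\<close>, taken at the first
  \<open>n\<close> for which the ancestors agree, so that it matches the formula on \<open>A_set E v n\<close>.  The quotient is the
  same for every larger \<open>n\<close>.
\<close>

definition profile :: "'v \<Rightarrow> 'v \<Rightarrow> real" where
  "profile v u = (if u \<in> gen v
     then (let n = (LEAST n. anc n u = anc n v) in lpow n u / lpow n v) else 0)"

lemma profile_eq:
  assumes "u \<in> V" "v \<in> V" "anc n u = anc n v"
  shows "profile v u = lpow n u / lpow n v"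
proof -
  define k where "k = (LEAST k. anc k u = anc k v)"
  have k: "anc k u = anc k v" "k \<le> n"
    unfolding k_def using assms(3) by (auto intro: LeastI Least_le)
  have split: "lpow n w = lpow k w * lpow (n - k) (anc k w)" for w
    using lpow_add[of k "n - k" w] k by simp
  have "lpow (n - k) (anc k v) > 0" using assms by (simp add: lpow_pos anc_in_V)
  then have "lpow n u / lpow n v = lpow k u / lpow k v"
    using k split[of u] split[of v] by simp
  moreover have "u \<in> gen v" using assms by (auto simp: gen_def)
  ultimately show ?thesis by (simp add: profile_def k_def Let_def)
qed

lemma profile_on_A_set: "v \<in> V \<Longrightarrow> u \<in> A_set E v n \<Longrightarrow> lpow n u / lpow n v = profile v u"
  by (rule sym, rule profile_eq) (simp_all add: A_set_iff)

lemma profile_outside: "u \<notin> gen v \<Longrightarrow> profile v u = 0"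
  by (simp add: profile_def)

lemma profile_outside_V: "w \<notin> V \<Longrightarrow> profile v w = 0"
  by (rule profile_outside) (simp add: gen_def)

lemma coherent_profile:
  assumes v: "v \<in> V"
  shows "coherent (\<lambda>u. c * of_real (profile v u))"
  unfolding coherent_def
proof (intro allI ballI impI)
  fix n u w assume uw: "u \<in> V" "w \<in> V" "anc n u = anc n w"
  have "lpow n w * profile v u = lpow n u * profile v w"
  proof (cases "u \<in> gen v")
    case True
    then have "w \<in> gen v" using gen_iff_of_anc_eq[OF uw] by simp
    with True obtain i j where "anc i u = anc i v" "anc j w = anc j v" by (auto simp: gen_def)
    then have N: "anc (n + (i + j)) u = anc (n + (i + j)) v" "anc (n + (i + j)) w = anc (n + (i + j)) v"
      using anc_eq_mono[of i u v] anc_eq_mono[of j w v] by simp_all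
    show ?thesis
      unfolding profile_eq[OF uw(1) v N(1)] profile_eq[OF uw(2) v N(2)]
      using uw(3) by (simp add: lpow_add)
  next
    case False
    then show ?thesis using gen_iff_of_anc_eq[OF uw] by (simp add: profile_outside)
  qed
  then have "of_real (lpow n w * profile v u) = (of_real (lpow n u * profile v w) :: complex)"
    by simp
  then show "of_real (lpow n w) * (c * of_real (profile v u))
      = of_real (lpow n u) * (c * of_real (profile v w))"
    by (simp add: mult.left_commute)
qed

lemma coherent_eq_profile:
  assumes "coherent f" "v \<in> V" "u \<in> gen v"
  shows "f u = f v * of_real (profile v u)"
proof -
  obtain n where n: "u \<in> V" "anc n u = anc n v" using assms(3) by (auto simp: gen_def)
  then have "of_real (lpow n v) * f u = of_real (lpow n u) * f v"
    using assms unfolding coherent_def by blast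
  then show ?thesis
    using lpow_pos[OF assms(2), of n] by (simp add: profile_eq[OF n(1) assms(2) n(2)] field_simps)
qed

text \<open>
  The generation of \<open>c\<close> consists of the children of the generation of its parent, and going up one more
  step contributes the factor \<open>lam\<close> to both numerator and denominator of the profile.
\<close>

lemma shift_profile:
  assumes c: "c \<in> V"
  shows "S (\<lambda>w. of_real (profile (par E c) w)) = (\<lambda>w. of_real (lam c) * of_real (profile c w))"
proof
  fix w
  have "lam w * profile (par E c) (par E w) = lam c * profile c w" if w: "w \<in> V"
  proof (cases "w \<in> gen c")
    case True
    then obtain n where "par E w \<in> gen (par E c)" "anc n (par E w) = anc n (par E c)"
      using gen_par_iff[OF w] by (auto simp: gen_def)
    then have n: "anc n (par E w) = anc n (par E c)" "anc (Suc n) w = anc (Suc n) c"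
      by (simp_all add: anc_Suc del: funpow.simps)
    show ?thesis
      unfolding profile_eq[OF par_in_V[OF w] par_in_V[OF c] n(1)] profile_eq[OF w c n(2)]
      using lam_pos[OF c] by (simp add: lpow_Suc)
  next
    case False
    then show ?thesis using gen_par_iff[OF w] by (simp add: profile_outside)
  qed
  then show "S (\<lambda>w. of_real (profile (par E c) w)) w = of_real (lam c) * of_real (profile c w)"
    by (simp add: weighted_shift_def profile_outside_V flip: of_real_mult)
qed

lemma profile_ell2_iff:
  "(\<lambda>w. of_real (profile v w)) \<in> ell2 V \<longleftrightarrow> (\<lambda>w. (profile v w)\<^sup>2) summable_on V"
  by (simp add: ell2_def profile_outside_V)

text \<open>
  The sets \<open>A_set E v n\<close> partition the generation of \<open>v\<close>, so \<open>\<alpha>\<close> is the squared norm of the profile.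
\<close>

lemma alpha_finite_iff:
  assumes v: "v \<in> V"
  shows "alpha E lam v < \<infinity> \<longleftrightarrow> (\<lambda>w. of_real (profile v w)) \<in> ell2 V"
proof -
  have "alpha E lam v = (\<Sum>n. \<Sum>\<^sub>\<infinity>u\<in>A_set E v n. ennreal ((profile v u)\<^sup>2))"
    unfolding alpha_def by (intro suminf_cong infsum_cong) (simp only: profile_on_A_set[OF v])
  also have "\<dots> = (\<Sum>\<^sub>\<infinity>u\<in>gen v. ennreal ((profile v u)\<^sup>2))"
    unfolding UN_A_set[OF v, symmetric]
    by (rule suminf_infsum_ennreal_disjoint) (rule A_set_disjoint[OF v])
  finally have "alpha E lam v < \<infinity> \<longleftrightarrow> (\<lambda>w. (profile v w)\<^sup>2) summable_on gen v"
    by (simp only: infsum_ennreal_finite_iff_summable zero_le_power2)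
  also have "\<dots> \<longleftrightarrow> (\<lambda>w. (profile v w)\<^sup>2) summable_on V"
    by (rule summable_on_cong_neutral) (auto simp: profile_outside gen_def)
  finally show ?thesis by (simp add: profile_ell2_iff)
qed

text \<open>
  At a given point at most one pair \<open>(n, u)\<close> contributes to the double sum.
\<close>

lemma g_series_eq_profile:
  assumes v: "v \<in> V"
  shows "(\<Sum>n. \<Sum>\<^sub>\<infinity>u\<in>A_set E v n. of_real (lpow n u / lpow n v) * basis_vec u w)
    = complex_of_real (profile v w)"
proof -
  have inner: "(\<Sum>\<^sub>\<infinity>u\<in>A_set E v n. of_real (lpow n u / lpow n v) * basis_vec u w)
      = (if w \<in> A_set E v n then complex_of_real (profile v w) else 0)" for n
  proof -
    have "(\<Sum>\<^sub>\<infinity>u\<in>A_set E v n. of_real (lpow n u / lpow n v) * basis_vec u w)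
        = (\<Sum>\<^sub>\<infinity>u\<in>A_set E v n \<inter> {w}. complex_of_real (profile v u))"
    proof (rule infsum_cong_neutral)
      show "of_real (lpow n u / lpow n v) * basis_vec u w = (0 :: complex)"
        if "u \<in> A_set E v n - A_set E v n \<inter> {w}" for u
        using that by (auto simp: basis_vec_def)
      show "of_real (lpow n u / lpow n v) * basis_vec u w = complex_of_real (profile v u)"
        if "u \<in> A_set E v n \<inter> (A_set E v n \<inter> {w})" for u
      proof -
        have "u \<in> A_set E v n" "basis_vec u w = 1" using that by (auto simp: basis_vec_def)
        then show ?thesis by (simp only: profile_on_A_set[OF v] mult_1_right)
      qed
    qed auto
    also have "\<dots> = (if w \<in> A_set E v n then complex_of_real (profile v w) else 0)"
      by simp
    finally show ?thesis .
  qed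
  show ?thesis
  proof (cases "w \<in> gen v")
    case True
    then obtain k where k: "w \<in> A_set E v k" using UN_A_set[OF v] by blast
    have "w \<in> A_set E v n \<longleftrightarrow> n = k" for n
      using k A_set_disjoint[OF v, of n k] by blast
    then show ?thesis
      unfolding inner using sums_single[of k "\<lambda>_. complex_of_real (profile v w)"]
      by (simp add: sums_iff)
  next
    case False
    then have "w \<notin> A_set E v n" for n using UN_A_set[OF v] by blast
    then show ?thesis unfolding inner using False by (simp add: profile_outside)
  qed
qed

end

context left_invertible_shift
begin

text \<open>
  The shift preserves and reflects square summability, and it maps one profile to a positive multiple of
  the other.
\<close>

lemma profile_par_ell2_iff:
  assumes c: "c \<in> V"
  shows "(\<lambda>w. of_real (profile (par E c) w)) \<in> ell2 V \<longleftrightarrow> (\<lambda>w. of_real (profile c w)) \<in> ell2 V"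
proof -
  have zero: "of_real (profile v w) = (0 :: complex)" if "w \<notin> V" for v w
    using that by (simp add: profile_outside_V)
  have "(\<lambda>w. of_real (profile (par E c) w)) \<in> ell2 V
      \<longleftrightarrow> S (\<lambda>w. of_real (profile (par E c) w)) \<in> ell2 V"
    by (rule iffI[OF shift_in_ell2 ell2_if_shift_ell2[OF zero]])
  also have "\<dots> \<longleftrightarrow> (\<lambda>w. of_real (profile c w)) \<in> ell2 V"
    unfolding shift_profile[OF c]
    using ell2_scale[of "\<lambda>w. of_real (lam c) * of_real (profile c w)" V "inverse (of_real (lam c))"]
      ell2_scale[of "\<lambda>w. of_real (profile c w)" V "of_real (lam c)"] lam_pos[OF c]
    by (auto simp flip: mult.assoc)
  finally show ?thesis .
qed

end


section \<open>The orthogonal decomposition\<close>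

locale left_invertible_shift_with_path =
  left_invertible_shift V E lam + rootless_tree_with_path V E p
  for V :: "'v set" and E :: "('v \<times> 'v) set" and lam :: "'v \<Rightarrow> real" and p :: "int \<Rightarrow> 'v"
begin

abbreviation g :: "int \<Rightarrow> 'v \<Rightarrow> complex" where
  "g \<equiv> g_vec E lam p"

lemma g_eq:
  "g m = (if (\<lambda>w. of_real (profile (p m) w)) \<in> ell2 V
          then (\<lambda>w. of_real (profile (p m) w)) else (\<lambda>w. 0))"
  unfolding g_vec_def alpha_finite_iff[OF path_in_V] g_series_eq_profile[OF path_in_V] ..

lemma g_in_ell2: "g m \<in> ell2 V"
  by (simp add: g_eq zero_in_ell2)

lemma g_outside: "w \<notin> gen (p m) \<Longrightarrow> g m w = 0"
  by (simp add: g_eq profile_outside)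

lemma coherent_multiple_g: "coherent (\<lambda>w. c * g m w)"
  using coherent_profile[OF path_in_V, of c] coherent_profile[OF path_in_V, of 0] by (simp add: g_eq)

lemma shift_g: "S (g m) = (\<lambda>w. of_real (lam (p (m + 1))) * g (m + 1) w)"
proof -
  have par: "par E (p (m + 1)) = p m" by (simp add: par_path)
  have "S (\<lambda>w. 0) = (\<lambda>w. 0)" by (auto simp: weighted_shift_def)
  then show ?thesis
    using shift_profile[OF path_in_V, of "m + 1"] profile_par_ell2_iff[OF path_in_V, of "m + 1"]
    by (simp add: g_eq par)
qed

lemma orthogonal_multiples_g:
  assumes "i \<noteq> j"
  shows "ell2_inner V (\<lambda>w. a * g i w) (\<lambda>w. b * g j w) = 0"
proof -
  have "g i w = 0 \<or> g j w = 0" if "w \<in> V" for w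
    using unique_path_vertex_in_generation[OF that] assms g_outside by blast
  then show ?thesis unfolding ell2_inner_def by (intro infsum_0) auto
qed

text \<open>
  The summand with index \<open>m\<close> is the restriction of \<open>f\<close> to the generation of \<open>v\<^sub>m\<close>, and the generations
  partition the vertices.
\<close>

lemma coherent_ell2_decomposes:
  assumes f: "f \<in> ell2 V" and coh: "coherent f"
  shows "ell2_has_sum V (\<lambda>m w. f (p m) * g m w) UNIV f"
proof -
  define l where "l = (\<lambda>w. THE m. w \<in> gen (p m))"
  have l: "l w = m \<longleftrightarrow> w \<in> gen (p m)" if "w \<in> V" for w m
    unfolding l_def using theI'[OF unique_path_vertex_in_generation[OF that]]
      unique_path_vertex_in_generation[OF that] by blast
  have piece: "f (p m) * g m w = (if l w = m then f w else 0)" for m w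
  proof (cases "w \<in> gen (p m)")
    case True
    then have "w \<in> V" by (simp add: gen_def)
    have eq: "f u = f (p m) * of_real (profile (p m) u)" if "u \<in> gen (p m)" for u
      using coherent_eq_profile[OF coh path_in_V that] .
    have "f (p m) * g m w = f w"
    proof (cases "f (p m) = 0")
      case False
      \<comment> \<open>Here the profile is a restriction of \<open>f\<close>, up to a constant, and hence square summable.\<close>
      have "(\<lambda>w. inverse (f (p m)) * f w) \<in> ell2 V" using f by (rule ell2_scale)
      then have "(\<lambda>w. of_real (profile (p m) w)) \<in> ell2 V"
      proof (rule ell2_dominated)
        fix u
        show "cmod (of_real (profile (p m) u)) \<le> cmod (inverse (f (p m)) * f u)"
          using False eq[of u]
          by (cases "u \<in> gen (p m)") (simp_all add: profile_outside flip: mult.assoc)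
      qed (simp add: profile_outside_V)
      then show ?thesis using eq[OF True] by (simp add: g_eq)
    qed (use eq[OF True] in simp)
    then show ?thesis using l[OF \<open>w \<in> V\<close>] True by simp
  next
    case False
    then show ?thesis using l[of w m] f by (cases "w \<in> V") (auto simp: g_outside ell2_def)
  qed
  show ?thesis unfolding piece by (rule ell2_has_sum_partition[OF f])
qed

text \<open>
  At each point only one summand survives, and vertices with a common ancestor lie in the same
  generation, so coherence passes from the summands to the sum.
\<close>

lemma coherent_if_sum_of_multiples_g:
  assumes f: "f \<in> ell2 V" and sum: "ell2_has_sum V (\<lambda>m w. c m * g m w) UNIV f"
  shows "coherent f"
proof -
  have f_eq: "f w = c m * g m w" if "w \<in> gen (p m)" for w m
  proof (rule ell2_has_sum_value_at_single_index[OF sum f])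
    show w: "w \<in> V" using that by (simp add: gen_def)
    show "c i * g i w = 0" if "i \<noteq> m" for i
      using unique_path_vertex_in_generation[OF w] \<open>w \<in> gen (p m)\<close> that g_outside by auto
  qed (auto intro: ell2_scale g_in_ell2)
  show ?thesis unfolding coherent_def
  proof (intro allI ballI impI)
    fix n u v assume uv: "u \<in> V" "v \<in> V" "anc n u = anc n v"
    obtain m where u: "u \<in> gen (p m)" using unique_path_vertex_in_generation[OF uv(1)] by blast
    then have v: "v \<in> gen (p m)" using gen_iff_of_anc_eq[OF uv] by simp
    show "of_real (lpow n v) * f u = of_real (lpow n u) * f v"
      unfolding f_eq[OF u] f_eq[OF v]
      using coherent_multiple_g[of "c m" m] uv unfolding coherent_def by blast
  qed
qed

lemma hyper_range_orthogonal_direct_sum: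
  "is_orthogonal_direct_sum V UNIV (\<lambda>m. cspan {g m}) (hyper_range V S)"
  unfolding is_orthogonal_direct_sum_def
proof (intro conjI ballI impI)
  show "cspan {g i} \<subseteq> ell2 V" for i
    using ell2_scale[OF g_in_ell2] by (auto simp: cspan_singleton)
  show "ell2_inner V f h = 0" if "i \<noteq> j" "f \<in> cspan {g i}" "h \<in> cspan {g j}" for i j f h
    using that orthogonal_multiples_g by (auto simp: cspan_singleton)
  have "coherent f \<longleftrightarrow> (\<exists>x. (\<forall>i\<in>UNIV. x i \<in> cspan {g i}) \<and> ell2_has_sum V x UNIV f)"
    if f: "f \<in> ell2 V" for f
  proof
    assume "coherent f"
    then have "ell2_has_sum V (\<lambda>m w. f (p m) * g m w) UNIV f"
      using f by (rule coherent_ell2_decomposes[rotated])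
    then show "\<exists>x. (\<forall>i\<in>UNIV. x i \<in> cspan {g i}) \<and> ell2_has_sum V x UNIV f"
      by (intro exI[of _ "\<lambda>m w. f (p m) * g m w"]) (auto simp: cspan_singleton)
  next
    assume "\<exists>x. (\<forall>i\<in>UNIV. x i \<in> cspan {g i}) \<and> ell2_has_sum V x UNIV f"
    then obtain x where x: "\<And>i. x i \<in> cspan {g i}" "ell2_has_sum V x UNIV f" by blast
    then have "\<exists>c. \<forall>i. x i = (\<lambda>w. c i * g i w)"
      by (intro choice) (auto simp: cspan_singleton)
    then obtain c where "x = (\<lambda>i w. c i * g i w)" by blast
    then show "coherent f" using coherent_if_sum_of_multiples_g[OF f] x(2) by simp
  qed
  then show "hyper_range V S
      = {f \<in> ell2 V. \<exists>x. (\<forall>i\<in>UNIV. x i \<in> cspan {g i}) \<and> ell2_has_sum V x UNIV f}"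
    unfolding hyper_range_eq_coherent by blast
qed

end

theorem theorem3p1:
  fixes V :: "'v set" and E :: "('v \<times> 'v) set"
    and lam :: "'v \<Rightarrow> real" and p :: "int \<Rightarrow> 'v"
  assumes "directed_tree V E"
    and "countable V" and "infinite V"
    and "leafless V E" and "rootless V E"
    and "\<And>v. v \<in> V \<Longrightarrow> lam v > 0"
    and "bounded_operator V (weighted_shift V E lam)"
    and "left_invertible V (weighted_shift V E lam)"
    and "bilateral_path V E p"
  shows "(\<forall>m. g_vec E lam p m \<in> ell2 V) \<and>
    is_orthogonal_direct_sum V UNIV (\<lambda>m. cspan {g_vec E lam p m})
      (hyper_range V (weighted_shift V E lam)) \<and>
    (\<forall>m. weighted_shift V E lam (g_vec E lam p m) =
          (\<lambda>w. of_real (lam (p (m + 1))) * g_vec E lam p (m + 1) w))"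
proof -
  interpret left_invertible_shift_with_path V E lam p
    using assms
    by (auto simp: left_invertible_shift_with_path_def left_invertible_shift_def
        left_invertible_shift_axioms_def weighted_tree_def weighted_tree_axioms_def
        rootless_directed_tree_def rootless_directed_tree_axioms_def
        rootless_tree_with_path_def rootless_tree_with_path_axioms_def)
  show ?thesis using g_in_ell2 hyper_range_orthogonal_direct_sum shift_g by blast
qed

end
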